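(* Let $x_1, \ldots, x_n \in \mathbb{R}^d$ and let $A$ be the $n\times n$ matrix with $A_{i,j} = f(x_i, x_j)$, where $f(x,y) = \max_{a \in [d], b \in [d]} |x(a) - y(b)|$. Then one can compute $Ay$ for any query $y \in \mathbb{R}^n$ exactly, using $O(nd)$ preprocessing time (independent of $y$) and $O(n^2)$ query time.
   Context: $x(a)$ denotes the $a$th coordinate of $x$; $[d] = \{1, \ldots, d\}$. *)

theory Defs
  imports "Jordan_Normal_Form.Matrix"
begin

definition linf_cross :: "real vec \<Rightarrow> real vec \<Rightarrow> real" where
  "linf_cross u v = Max {\<bar>u $ a - v $ b\<bar> | a b. a < dim_vec u \<and> b < dim_vec v}"

definition cross_mat :: "nat \<Rightarrow> (nat \<Rightarrow> real vec) \<Rightarrow> real mat" where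
  "cross_mat n x = mat n n (\<lambda>(i, j). linf_cross (x i) (x j))"


text \<open>
  Running time is measured on a real RAM. One memory holds natural numbers, used for addressing
  and loop control; the other holds exact real numbers. Real memory consists of a working area and
  three areas through which the input points, the query vector and the answer are communicated.
  Every instruction and every test costs one time step. Integer arithmetic is limited to addition
  and truncated subtraction, and there is no conversion between the two memories (in particular no
  floor operation).
\<close>

datatype bank = Points | Query | Answer | Work

record state =
  imem :: "nat \<Rightarrow> nat"
  rmem :: "bank \<Rightarrow> nat \<Rightarrow> real"

text \<open>\<open>Ind k\<close> is the cell whose number is stored in integer cell \<open>k\<close>.\<close>

datatype addr = Dir nat | Ind nat

type_synonym cell = "bank \<times> addr"

fun loc :: "addr \<Rightarrow> state \<Rightarrow> nat" where
  "loc (Dir k) s = k"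
| "loc (Ind k) s = imem s k"

definition ival :: "addr \<Rightarrow> state \<Rightarrow> nat" where
  "ival p s = imem s (loc p s)"

definition iset :: "addr \<Rightarrow> nat \<Rightarrow> state \<Rightarrow> state" where
  "iset p v s = s\<lparr>imem := (imem s)(loc p s := v)\<rparr>"

definition rval :: "cell \<Rightarrow> state \<Rightarrow> real" where
  "rval c s = rmem s (fst c) (loc (snd c) s)"

definition rset :: "cell \<Rightarrow> real \<Rightarrow> state \<Rightarrow> state" where
  "rset c v s =
     s\<lparr>rmem := (rmem s)(fst c := (rmem s (fst c))(loc (snd c) s := v))\<rparr>"

datatype instr =
    IConst addr nat
  | IMove addr addr
  | IAdd addr addr addr
  | ISub addr addr addr
  | RConst cell int
  | RMove cell cell
  | RAdd cell cell cell
  | RSub cell cell cell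
  | RMul cell cell cell
  | RDiv cell cell cell

text \<open>The first argument of an instruction is its destination. Division by zero is a fault.\<close>

fun step :: "instr \<Rightarrow> state \<Rightarrow> state option" where
  "step (IConst p k) s = Some (iset p k s)"
| "step (IMove p q) s = Some (iset p (ival q s) s)"
| "step (IAdd p q r) s = Some (iset p (ival q s + ival r s) s)"
| "step (ISub p q r) s = Some (iset p (ival q s - ival r s) s)"
| "step (RConst a k) s = Some (rset a (of_int k) s)"
| "step (RMove a b) s = Some (rset a (rval b s) s)"
| "step (RAdd a b c) s = Some (rset a (rval b s + rval c s) s)"
| "step (RSub a b c) s = Some (rset a (rval b s - rval c s) s)"
| "step (RMul a b c) s = Some (rset a (rval b s * rval c s) s)"
| "step (RDiv a b c) s =
     (if rval c s = 0 then None else Some (rset a (rval b s / rval c s) s))"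

datatype test = ILess addr addr | RLess cell cell

fun holds :: "test \<Rightarrow> state \<Rightarrow> bool" where
  "holds (ILess p q) s \<longleftrightarrow> ival p s < ival q s"
| "holds (RLess a b) s \<longleftrightarrow> rval a s < rval b s"

datatype prog =
    Skip
  | Do instr
  | Seq prog prog
  | Cond test prog prog
  | Loop test prog

text \<open>
  \<open>exec P s t s'\<close>: started in \<open>s\<close>, the program \<open>P\<close> halts without
  a fault in \<open>s'\<close> after exactly \<open>t\<close> steps.
\<close>

inductive exec :: "prog \<Rightarrow> state \<Rightarrow> nat \<Rightarrow> state \<Rightarrow> bool" where
  Skip: "exec Skip s 1 s"
| Do: "step i s = Some s' \<Longrightarrow> exec (Do i) s 1 s'"
| Seq: "exec P s t s' \<Longrightarrow> exec Q s' u s'' \<Longrightarrow> exec (Seq P Q) s (t + u) s''"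
| CondTrue: "holds b s \<Longrightarrow> exec P s t s' \<Longrightarrow> exec (Cond b P Q) s (1 + t) s'"
| CondFalse: "\<not> holds b s \<Longrightarrow> exec Q s t s' \<Longrightarrow> exec (Cond b P Q) s (1 + t) s'"
| LoopTrue: "holds b s \<Longrightarrow> exec P s t s' \<Longrightarrow> exec (Loop b P) s' u s''
    \<Longrightarrow> exec (Loop b P) s (1 + t + u) s''"
| LoopFalse: "\<not> holds b s \<Longrightarrow> exec (Loop b P) s 1 s"

inductive_cases exec_SkipE: "exec Skip s t s'"
inductive_cases exec_DoE: "exec (Do i) s t s'"
inductive_cases exec_SeqE: "exec (Seq P Q) s t s'"
inductive_cases exec_CondE: "exec (Cond b P Q) s t s'"
inductive_cases exec_LoopE: "exec (Loop b P) s t s'"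

lemma exec_deterministic:
  "exec P s t s' \<Longrightarrow> exec P s u s'' \<Longrightarrow> u = t \<and> s'' = s'"
proof (induction arbitrary: u s'' rule: exec.induct)
  case (Skip s)
  then show ?case by (auto elim: exec_SkipE)
next
  case (Do i s s')
  then show ?case by (auto elim: exec_DoE)
next
  case (Seq P s t s' Q v s1)
  from Seq.prems obtain t1 s2 v1 where *: "exec P s t1 s2" "exec Q s2 v1 s''" "u = t1 + v1"
    by (rule exec_SeqE)
  from Seq.IH(1)[OF *(1)] have "t1 = t" "s2 = s'" by simp_all
  with Seq.IH(2)[of v1 s''] * show ?case by simp
next
  case (CondTrue b s P t s' Q)
  from CondTrue.prems CondTrue.hyps(1) obtain t1 where *: "exec P s t1 s''" "u = 1 + t1"
    by (auto elim: exec_CondE)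
  from CondTrue.IH[OF *(1)] *(2) show ?case by simp
next
  case (CondFalse b s Q t s' P)
  from CondFalse.prems CondFalse.hyps(1) obtain t1 where *: "exec Q s t1 s''" "u = 1 + t1"
    by (auto elim: exec_CondE)
  from CondFalse.IH[OF *(1)] *(2) show ?case by simp
next
  case (LoopTrue b s P t s' v s1)
  from LoopTrue.prems LoopTrue.hyps(1) obtain t1 s2 v1
    where *: "exec P s t1 s2" "exec (Loop b P) s2 v1 s''" "u = 1 + t1 + v1"
    by (auto elim: exec_LoopE)
  from LoopTrue.IH(1)[OF *(1)] have "t1 = t" "s2 = s'" by simp_all
  with LoopTrue.IH(2)[of v1 s''] * show ?case by simp
next
  case (LoopFalse b s P)
  from LoopFalse.prems show ?case
    by (rule exec_LoopE) (use LoopFalse.hyps in auto)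
qed

text \<open>
  The points are stored row by row. All cells not mentioned have arbitrary contents.
\<close>

definition holds_points :: "nat \<Rightarrow> nat \<Rightarrow> (nat \<Rightarrow> real vec) \<Rightarrow> state \<Rightarrow> bool" where
  "holds_points n d x s \<longleftrightarrow>
     imem s 0 = n \<and> imem s 1 = d \<and>
     (\<forall>i<n. \<forall>a<d. rmem s Points (i * d + a) = x i $ a)"

definition load_query :: "real vec \<Rightarrow> state \<Rightarrow> state" where
  "load_query y s =
     s\<lparr>rmem := (rmem s)(Query := (\<lambda>i. if i < dim_vec y then y $ i else rmem s Query i))\<rparr>"

definition answer :: "nat \<Rightarrow> state \<Rightarrow> real vec" where
  "answer n s = vec n (rmem s Answer)"

text \<open>
  The states in which the next query of dimension \<open>n\<close> may arrive: those left behind by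
  preprocessing the initial state \<open>s0\<close> and then answering any finite number of queries.
\<close>

inductive serving :: "prog \<Rightarrow> prog \<Rightarrow> nat \<Rightarrow> state \<Rightarrow> state \<Rightarrow> bool"
  for pre query :: prog and n :: nat and s0 :: state where
  preprocessed: "exec pre s0 t s \<Longrightarrow> serving pre query n s0 s"
| answered: "serving pre query n s0 s \<Longrightarrow> y \<in> carrier_vec n \<Longrightarrow> exec query (load_query y s) t s'
    \<Longrightarrow> serving pre query n s0 s'"

end

theory Submission
  imports Defs
begin

text \<open>
  Since \<open>\<bar>p - q\<bar> = max (p - q) (q - p)\<close>, the distance is
  \<open>f(u, v) = max (max u - min v) (max v - min u)\<close>, where \<open>max\<close> and \<open>min\<close> range over the
  coordinates. Preprocessing stores the largest and the smallest coordinate of every point;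
  afterwards each matrix entry is available in constant time.
\<close>

section \<open>The distance in terms of coordinate extrema\<close>

lemma linf_cross_eq_max:
  assumes "u \<in> carrier_vec d" "v \<in> carrier_vec d" "d \<ge> 1"
  shows "linf_cross u v = max (Max (($) u ` {..<d}) - Min (($) v ` {..<d}))
                              (Max (($) v ` {..<d}) - Min (($) u ` {..<d}))"
    (is "_ = max (?Mu - ?mv) (?Mv - ?mu)")
proof -
  let ?D = "{\<bar>u $ a - v $ b\<bar> | a b. a < d \<and> b < d}"
  have D: "?D = (\<lambda>(a, b). \<bar>u $ a - v $ b\<bar>) ` ({..<d} \<times> {..<d})"
    by auto
  then have fin: "finite ?D" by simp
  have ne: "{..<d} \<noteq> {}" using assms(3) by (auto simp: lessThan_empty_iff)
  have attained: "\<exists>a<d. Max (($) w ` {..<d}) = w $ a" "\<exists>a<d. Min (($) w ` {..<d}) = w $ a"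
    for w :: "real vec"
  proof -
    have "Max (($) w ` {..<d}) \<in> ($) w ` {..<d}" "Min (($) w ` {..<d}) \<in> ($) w ` {..<d}"
      using ne by simp_all
    then show "\<exists>a<d. Max (($) w ` {..<d}) = w $ a" "\<exists>a<d. Min (($) w ` {..<d}) = w $ a"
      by auto
  qed
  have bounds: "w $ a \<le> Max (($) w ` {..<d})" "Min (($) w ` {..<d}) \<le> w $ a"
    if "a < d" for w :: "real vec" and a
    using that by auto
  have in_D: "\<bar>u $ a - v $ b\<bar> \<le> Max ?D" if "a < d" "b < d" for a b
    using that fin by (intro Max_ge) auto
  have "Max ?D = max (?Mu - ?mv) (?Mv - ?mu)"
  proof (rule antisym)
    show "Max ?D \<le> max (?Mu - ?mv) (?Mv - ?mu)"
    proof (rule Max.boundedI[OF fin])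
      show "?D \<noteq> {}" using D ne by simp
      fix r assume "r \<in> ?D"
      then obtain a b where ab: "a < d" "b < d" "r = \<bar>u $ a - v $ b\<bar>" by auto
      show "r \<le> max (?Mu - ?mv) (?Mv - ?mu)"
        using bounds[OF ab(1), of u] bounds[OF ab(2), of v] ab(3) by linarith
    qed
    \<comment> \<open>Conversely, both arguments of \<open>max\<close> are differences of attained
      coordinates, hence at most an absolute value in \<open>?D\<close>.\<close>
    obtain a b where "a < d" "b < d" "?Mu = u $ a" "?mv = v $ b"
      using attained by meson
    with in_D[of a b] have "?Mu - ?mv \<le> Max ?D" by linarith
    moreover obtain a b where "a < d" "b < d" "?mu = u $ a" "?Mv = v $ b"
      using attained by meson
    with in_D[of a b] have "?Mv - ?mu \<le> Max ?D" by linarith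
    ultimately show "max (?Mu - ?mv) (?Mv - ?mu) \<le> Max ?D" by simp
  qed
  then show ?thesis using assms by (simp add: linf_cross_def)
qed

section \<open>Execution within a time bound\<close>

definition runs :: "prog \<Rightarrow> state \<Rightarrow> nat \<Rightarrow> (state \<Rightarrow> bool) \<Rightarrow> bool" where
  "runs P s T R \<longleftrightarrow> (\<exists>t s'. exec P s t s' \<and> t \<le> T \<and> R s')"

lemma runs_mono:
  assumes "runs P s T R" "T \<le> T'" "\<And>s'. R s' \<Longrightarrow> R' s'"
  shows "runs P s T' R'"
  using assms unfolding runs_def by (meson le_trans)

lemma runs_Seq:
  assumes "runs P s T R'" "\<And>s'. R' s' \<Longrightarrow> runs Q s' U R"
  shows "runs (Seq P Q) s (T + U) R"
  using assms unfolding runs_def by (meson add_mono exec.Seq)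

lemma exec_iff:
  "exec Skip s t s' \<longleftrightarrow> t = 1 \<and> s' = s"
  "exec (Do i) s t s' \<longleftrightarrow> t = 1 \<and> step i s = Some s'"
  "exec (Seq P Q) s t s' \<longleftrightarrow> (\<exists>u v s1. t = u + v \<and> exec P s u s1 \<and> exec Q s1 v s')"
  "exec (Cond b P Q) s t s' \<longleftrightarrow> (\<exists>u. t = 1 + u \<and> exec (if holds b s then P else Q) s u s')"
proof -
  show "exec Skip s t s' \<longleftrightarrow> t = 1 \<and> s' = s"
    by (metis exec.Skip exec_SkipE)
  show "exec (Do i) s t s' \<longleftrightarrow> t = 1 \<and> step i s = Some s'"
    by (metis exec.Do exec_DoE)
  show "exec (Seq P Q) s t s' \<longleftrightarrow> (\<exists>u v s1. t = u + v \<and> exec P s u s1 \<and> exec Q s1 v s')"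
    by (metis exec.Seq exec_SeqE)
  show "exec (Cond b P Q) s t s' \<longleftrightarrow>
      (\<exists>u. t = 1 + u \<and> exec (if holds b s then P else Q) s u s')"
    by (cases "holds b s"; simp; metis exec.CondTrue exec.CondFalse exec_CondE plus_1_eq_Suc)
qed

text \<open>Symbolic execution by rewriting: each instruction or test pays one unit of the budget
  \<open>T\<close>. The guard \<open>1 \<le> T\<close> keeps the truncated subtraction
  exact.\<close>

lemma runs_simps:
  "runs Skip s T R \<longleftrightarrow> 1 \<le> T \<and> R s"
  "runs (Do i) s T R \<longleftrightarrow> 1 \<le> T \<and> (\<exists>s'. step i s = Some s' \<and> R s')"
  "runs (Seq Skip Q) s T R \<longleftrightarrow> 1 \<le> T \<and> runs Q s (T - 1) R"
  "runs (Seq (Do i) Q) s T R \<longleftrightarrow> 1 \<le> T \<and> (\<exists>s'. step i s = Some s' \<and> runs Q s' (T - 1) R)"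
  "runs (Seq (Cond b P P') Q) s T R \<longleftrightarrow>
     1 \<le> T \<and> runs (Seq (if holds b s then P else P') Q) s (T - 1) R"
  by (cases T; auto simp: runs_def exec_iff; metis add_Suc Suc_le_mono)+

text \<open>\<open>I k\<close> describes the state after \<open>k\<close> iterations. Each iteration
  pays for its test and its body; the final failing test adds 1.\<close>

lemma runs_Loop:
  assumes "I 0 s" "\<And>k s. k < N \<Longrightarrow> I k s \<Longrightarrow> holds b s \<and> runs P s T (I (Suc k))"
    "\<And>s. I N s \<Longrightarrow> \<not> holds b s"
  shows "runs (Loop b P) s (N * (1 + T) + 1) (I N)"
proof -
  \<comment> \<open>The induction is over the number \<open>m\<close> of remaining iterations, since
    \<open>exec\<close> peels off the first one.\<close>
  have "runs (Loop b P) s (m * (1 + T) + 1) (I N)" if "I (N - m) s" "m \<le> N" for m s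
    using that
  proof (induction m arbitrary: s)
    case 0
    then show ?case using assms(3) exec.LoopFalse by (fastforce simp: runs_def)
  next
    case (Suc m)
    then have "holds b s" "runs P s T (I (N - m))"
      using assms(2)[of "N - Suc m" s] by (simp_all add: Suc_diff_Suc)
    then obtain t s1 where 1: "exec P s t s1" "t \<le> T" "I (N - m) s1"
      by (auto simp: runs_def)
    with Suc.IH[of s1] Suc.prems
    obtain u s2 where 2: "exec (Loop b P) s1 u s2" "u \<le> m * (1 + T) + 1" "I N s2"
      by (auto simp: runs_def)
    have "exec (Loop b P) s (1 + t + u) s2"
      using \<open>holds b s\<close> 1(1) 2(1) by (rule exec.LoopTrue)
    moreover have "1 + t + u \<le> Suc m * (1 + T) + 1"
      using 1(2) 2(2) by simp
    ultimately show ?case using 2(3) unfolding runs_def by blast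
  qed
  from this[of N s] assms(1) show ?thesis by simp
qed

lemmas exec_simps = runs_simps ival_def iset_def rval_def rset_def

section \<open>Preprocessing\<close>

text \<open>
  The largest coordinate of point \<open>i\<close> is kept in \<open>Work\<close> cell \<open>i\<close> and the smallest one in
  \<open>Query\<close> cell \<open>n + i\<close>, which lies outside the part of the query area overwritten by
  \<open>load_query\<close>. Integer cells 0 and 1 hold \<open>n\<close> and \<open>d\<close>.
\<close>

definition extrema_stored :: "nat \<Rightarrow> nat \<Rightarrow> nat \<Rightarrow> (nat \<Rightarrow> real vec) \<Rightarrow> state \<Rightarrow> bool" where
  "extrema_stored m n d x s \<longleftrightarrow>
     (\<forall>i<m. rmem s Work i = Max (($) (x i) ` {..<d}) \<and>
            rmem s Query (n + i) = Min (($) (x i) ` {..<d}))"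

text \<open>The invariant between queries. It speaks of the extrema rather than the points, whose
  cells are overwritten while a query is answered.\<close>

definition ready :: "nat \<Rightarrow> nat \<Rightarrow> (nat \<Rightarrow> real vec) \<Rightarrow> state \<Rightarrow> bool" where
  "ready n d x s \<longleftrightarrow> imem s 0 = n \<and> extrema_stored n n d x s"

text \<open>
  In integer memory, cell 2 holds the constant 1, cell 3 the index \<open>i\<close> of the current point and
  cell 4 the number \<open>n + i\<close>; in the preprocessing, cell 5 addresses the current coordinate and
  cell 6 the end of the current row.
\<close>

definition scan_body :: prog where
  "scan_body =
     Seq (Cond (RLess (Work, Ind 3) (Points, Ind 5)) (Do (RMove (Work, Ind 3) (Points, Ind 5))) Skip)
    (Seq (Cond (RLess (Points, Ind 5) (Query, Ind 4)) (Do (RMove (Query, Ind 4) (Points, Ind 5))) Skip)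
         (Do (IAdd (Dir 5) (Dir 5) (Dir 2))))"

text \<open>Row ends arise by repeated addition of \<open>d\<close>, as integer memory has no
  multiplication. The extrema start from the first coordinate, as no real number is neutral for
  maximum or minimum.\<close>

definition row_start :: prog where
  "row_start =
     Seq (Do (IAdd (Dir 6) (Dir 6) (Dir 1)))
    (Seq (Do (RMove (Work, Ind 3) (Points, Ind 5)))
         (Do (RMove (Query, Ind 4) (Points, Ind 5))))"

definition next_point :: prog where
  "next_point = Seq (Do (IAdd (Dir 3) (Dir 3) (Dir 2))) (Do (IAdd (Dir 4) (Dir 4) (Dir 2)))"

definition first_row :: prog where
  "first_row =
     Seq (Do (IConst (Dir 2) 1)) (Seq (Do (IConst (Dir 3) 0)) (Seq (Do (IMove (Dir 4) (Dir 0)))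
    (Seq (Do (IConst (Dir 5) 0)) (Do (IConst (Dir 6) 0)))))"

definition preprocess :: prog where
  "preprocess =
     Seq first_row
    (Loop (ILess (Dir 3) (Dir 0))
       (Seq row_start (Seq (Loop (ILess (Dir 5) (Dir 6)) scan_body) next_point)))"

definition row_inv :: "nat \<Rightarrow> nat \<Rightarrow> (nat \<Rightarrow> real vec) \<Rightarrow> nat \<Rightarrow> state \<Rightarrow> bool" where
  "row_inv n d x k s \<longleftrightarrow>
     holds_points n d x s \<and> imem s 2 = 1 \<and> imem s 3 = k \<and> imem s 4 = n + k \<and>
     imem s 5 = k * d \<and> imem s 6 = k * d \<and> extrema_stored k n d x s"

text \<open>
  Inserting the index 0 makes the extrema meaningful for \<open>a = 0\<close>, matching \<^term>\<open>row_start\<close>.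
\<close>

definition scan_inv :: "nat \<Rightarrow> nat \<Rightarrow> (nat \<Rightarrow> real vec) \<Rightarrow> nat \<Rightarrow> nat \<Rightarrow> state \<Rightarrow> bool" where
  "scan_inv n d x k a s \<longleftrightarrow>
     holds_points n d x s \<and> imem s 2 = 1 \<and> imem s 3 = k \<and> imem s 4 = n + k \<and>
     imem s 5 = k * d + a \<and> imem s 6 = k * d + d \<and> extrema_stored k n d x s \<and>
     rmem s Work k = Max (($) (x k) ` insert 0 {..<a}) \<and>
     rmem s Query (n + k) = Min (($) (x k) ` insert 0 {..<a})"

lemma scan_body_correct:
  assumes "scan_inv n d x k a s" "k < n" "a < d"
  shows "runs scan_body s 5 (scan_inv n d x k (Suc a))"
proof -
  have p: "rmem s Points (k * d + a) = x k $ a"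
    using assms by (auto simp: scan_inv_def holds_points_def)
  define hi lo where "hi = Max (($) (x k) ` insert 0 {..<a})" "lo = Min (($) (x k) ` insert 0 {..<a})"
  \<comment> \<open>Hence the two tests of \<open>scan_body\<close> cannot both succeed.\<close>
  have "lo \<le> hi"
    unfolding hi_lo_def by (rule order_trans[OF Min_le Max_ge, of _ "x k $ 0"]) auto
  have "($) (x k) ` insert 0 {..<Suc a} = insert (x k $ a) (($) (x k) ` insert 0 {..<a})"
    by (auto simp: lessThan_Suc)
  then have "Max (($) (x k) ` insert 0 {..<Suc a}) = max (x k $ a) hi"
            "Min (($) (x k) ` insert 0 {..<Suc a}) = min (x k $ a) lo"
    unfolding hi_lo_def by (simp_all del: image_insert)
  with assms(1)[unfolded scan_inv_def, folded hi_lo_def] assms(2,3) p \<open>lo \<le> hi\<close> show ?thesis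
    by (simp add: scan_body_def exec_simps scan_inv_def holds_points_def extrema_stored_def max_def min_def
        del: image_insert)
qed

lemma row_correct:
  assumes "row_inv n d x k s" "k < n" "d \<ge> 1"
  shows "runs (Seq row_start (Seq (Loop (ILess (Dir 5) (Dir 6)) scan_body) next_point)) s
           (6 * d + 6) (row_inv n d x (Suc k))"
proof -
  have p: "rmem s Points (k * d) = x k $ 0"
    using assms by (force simp: row_inv_def holds_points_def)
  have start: "runs row_start s 3 (scan_inv n d x k 0)"
    using assms p
    by (auto simp: row_start_def exec_simps row_inv_def scan_inv_def holds_points_def
        extrema_stored_def)
  have scan: "runs (Loop (ILess (Dir 5) (Dir 6)) scan_body) s' (d * (1 + 5) + 1) (scan_inv n d x k d)"
    if "scan_inv n d x k 0 s'" for s'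
    using that by (rule runs_Loop)
      (use assms(2) in \<open>auto simp: scan_body_correct, auto simp: scan_inv_def ival_def\<close>)
  \<comment> \<open>As \<open>d \<ge> 1\<close>, the inserted index disappears at the end of the
    row, leaving the extrema of the whole point.\<close>
  have "insert 0 {..<d} = {..<d}"
    using assms(3) by auto
  then have finish: "runs next_point s' 2 (row_inv n d x (Suc k))" if "scan_inv n d x k d s'" for s'
    using that
    by (auto simp: next_point_def exec_simps row_inv_def scan_inv_def holds_points_def
        extrema_stored_def less_Suc_eq simp del: image_insert)
  have "runs (Seq row_start (Seq (Loop (ILess (Dir 5) (Dir 6)) scan_body) next_point)) s
           (3 + ((d * (1 + 5) + 1) + 2)) (row_inv n d x (Suc k))"
    by (intro runs_Seq[OF start] runs_Seq[OF scan] finish)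
  then show ?thesis
    by (rule runs_mono) auto
qed

lemma preprocess_correct:
  assumes "holds_points n d x s" "n \<ge> 1" "d \<ge> 1"
  shows "runs preprocess s (20 * (n * d)) (ready n d x)"
proof -
  let ?B = "Seq row_start (Seq (Loop (ILess (Dir 5) (Dir 6)) scan_body) next_point)"
  let ?T = "n * (1 + (6 * d + 6)) + 1"
  have loop: "runs (Loop (ILess (Dir 3) (Dir 0)) ?B) s' ?T (row_inv n d x n)"
    if "row_inv n d x 0 s'" for s'
    using that
    by (rule runs_Loop)
      (use assms(3) in \<open>auto simp: row_correct, auto simp: row_inv_def holds_points_def ival_def\<close>)
  have "runs preprocess s (5 + ?T) (row_inv n d x n)"
    unfolding preprocess_def
  proof (rule runs_Seq[OF _ loop])
    show "runs first_row s 5 (row_inv n d x 0)"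
      using assms(1)
      by (auto simp: first_row_def exec_simps row_inv_def holds_points_def extrema_stored_def)
  qed
  \<comment> \<open>The total \<open>6 * (n * d) + 7 * n + 6\<close> is at most
    \<open>19 * (n * d)\<close>.\<close>
  moreover have "5 + ?T \<le> 20 * (n * d)"
  proof -
    have "n \<le> n * d" "1 \<le> n * d" using assms(2,3) by auto
    moreover have "n * (1 + (6 * d + 6)) = 6 * (n * d) + 7 * n" by (simp add: algebra_simps)
    ultimately show ?thesis by linarith
  qed
  ultimately show ?thesis
    by (rule runs_mono) (auto simp: row_inv_def ready_def holds_points_def)
qed

section \<open>Answering a query\<close>

text \<open>
  When answering, integer cells 5 and 6 hold \<open>j\<close> and \<open>n + j\<close>. The points are no longer needed,
  so their area serves as scratch space.
\<close>

definition entry_body :: prog where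
  "entry_body =
     Seq (Do (RSub (Points, Dir 0) (Work, Ind 3) (Query, Ind 6)))
    (Seq (Do (RSub (Points, Dir 1) (Work, Ind 5) (Query, Ind 4)))
    (Seq (Cond (RLess (Points, Dir 0) (Points, Dir 1)) (Do (RMove (Points, Dir 0) (Points, Dir 1))) Skip)
    (Seq (Do (RMul (Points, Dir 0) (Points, Dir 0) (Query, Ind 5)))
    (Seq (Do (RAdd (Answer, Ind 3) (Answer, Ind 3) (Points, Dir 0)))
    (Seq (Do (IAdd (Dir 5) (Dir 5) (Dir 2)))
         (Do (IAdd (Dir 6) (Dir 6) (Dir 2))))))))"

definition sum_start :: prog where
  "sum_start =
     Seq (Do (RConst (Answer, Ind 3) 0))
    (Seq (Do (IConst (Dir 5) 0))
         (Do (IMove (Dir 6) (Dir 0))))"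

text \<open>The control cells are set afresh for every query, so \<open>ready\<close> needs to fix
  only integer cell 0.\<close>

definition first_point :: prog where
  "first_point =
     Seq (Do (IConst (Dir 2) 1)) (Seq (Do (IConst (Dir 3) 0)) (Do (IMove (Dir 4) (Dir 0))))"

definition answer_query :: prog where
  "answer_query =
     Seq first_point
    (Loop (ILess (Dir 3) (Dir 0))
       (Seq sum_start (Seq (Loop (ILess (Dir 5) (Dir 0)) entry_body) next_point)))"

definition answer_inv ::
    "nat \<Rightarrow> nat \<Rightarrow> (nat \<Rightarrow> real vec) \<Rightarrow> real vec \<Rightarrow> nat \<Rightarrow> state \<Rightarrow> bool" where
  "answer_inv n d x y k s \<longleftrightarrow>
     ready n d x s \<and> (\<forall>i<n. rmem s Query i = y $ i) \<and>
     imem s 2 = 1 \<and> imem s 3 = k \<and> imem s 4 = n + k \<and>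
     (\<forall>i<k. rmem s Answer i = (\<Sum>j<n. linf_cross (x i) (x j) * y $ j))"

definition sum_inv ::
    "nat \<Rightarrow> nat \<Rightarrow> (nat \<Rightarrow> real vec) \<Rightarrow> real vec \<Rightarrow> nat \<Rightarrow> nat \<Rightarrow> state \<Rightarrow> bool" where
  "sum_inv n d x y k l s \<longleftrightarrow>
     answer_inv n d x y k s \<and> imem s 5 = l \<and> imem s 6 = n + l \<and>
     rmem s Answer k = (\<Sum>j<l. linf_cross (x k) (x j) * y $ j)"

text \<open>Four stored extrema determine the entry by \<open>linf_cross_eq_max\<close>. Both
  branches of the conditional cost the same, since \<open>Skip\<close> also takes one step.\<close>

lemma entry_body_correct:
  assumes "sum_inv n d x y k l s" "k < n" "l < n" "d \<ge> 1" "\<forall>i<n. x i \<in> carrier_vec d"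
  shows "runs entry_body s 8 (sum_inv n d x y k (Suc l))"
proof -
  have "linf_cross (x k) (x l) =
      max (rmem s Work k - rmem s Query (n + l)) (rmem s Work l - rmem s Query (n + k))"
    using assms linf_cross_eq_max[of "x k" d "x l"]
    by (simp add: sum_inv_def answer_inv_def ready_def extrema_stored_def)
  then show ?thesis
    using assms(1-3)
    by (auto simp: entry_body_def exec_simps sum_inv_def answer_inv_def ready_def
        extrema_stored_def max_def)
qed

lemma sum_correct:
  assumes "answer_inv n d x y k s" "k < n" "d \<ge> 1" "\<forall>i<n. x i \<in> carrier_vec d"
  shows "runs (Seq sum_start (Seq (Loop (ILess (Dir 5) (Dir 0)) entry_body) next_point)) s
           (9 * n + 6) (answer_inv n d x y (Suc k))"
proof -
  have start: "runs sum_start s 3 (sum_inv n d x y k 0)"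
    using assms
    by (auto simp: sum_start_def exec_simps sum_inv_def answer_inv_def ready_def
        extrema_stored_def)
  have loop: "runs (Loop (ILess (Dir 5) (Dir 0)) entry_body) s' (n * (1 + 8) + 1) (sum_inv n d x y k n)"
    if "sum_inv n d x y k 0 s'" for s'
    using that by (rule runs_Loop)
      (use assms(2-4) in \<open>auto simp: entry_body_correct,
        auto simp: sum_inv_def answer_inv_def ready_def ival_def\<close>)
  have finish: "runs next_point s' 2 (answer_inv n d x y (Suc k))" if "sum_inv n d x y k n s'" for s'
    using that
    by (auto simp: next_point_def exec_simps sum_inv_def answer_inv_def ready_def
        extrema_stored_def less_Suc_eq)
  have "runs (Seq sum_start (Seq (Loop (ILess (Dir 5) (Dir 0)) entry_body) next_point)) s
           (3 + ((n * (1 + 8) + 1) + 2)) (answer_inv n d x y (Suc k))"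
    by (intro runs_Seq[OF start] runs_Seq[OF loop] finish)
  then show ?thesis
    by (rule runs_mono) auto
qed

lemma answer_query_correct:
  assumes "ready n d x s" "y \<in> carrier_vec n" "n \<ge> 1" "d \<ge> 1" "\<forall>i<n. x i \<in> carrier_vec d"
  shows "runs answer_query (load_query y s) (20 * n\<^sup>2)
           (\<lambda>s'. ready n d x s' \<and> answer n s' = cross_mat n x *\<^sub>v y)"
proof -
  let ?B = "Seq sum_start (Seq (Loop (ILess (Dir 5) (Dir 0)) entry_body) next_point)"
  let ?T = "n * (1 + (9 * n + 6)) + 1"
  have loop: "runs (Loop (ILess (Dir 3) (Dir 0)) ?B) s' ?T (answer_inv n d x y n)"
    if "answer_inv n d x y 0 s'" for s'
    using that
    by (rule runs_Loop)
      (use assms(4,5) in \<open>auto simp: sum_correct, auto simp: answer_inv_def ready_def ival_def\<close>)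
  have "runs answer_query (load_query y s) (3 + ?T) (answer_inv n d x y n)"
    unfolding answer_query_def
  proof (rule runs_Seq[OF _ loop])
    \<comment> \<open>As \<open>y\<close> has dimension \<open>n\<close>, loading it spares the
      minima stored from \<open>Query\<close> cell \<open>n\<close> on.\<close>
    show "runs first_point (load_query y s) 3 (answer_inv n d x y 0)"
      using assms(1,2)
      by (auto simp: first_point_def exec_simps answer_inv_def ready_def extrema_stored_def
          load_query_def)
  qed
  \<comment> \<open>The total is \<open>9 * (n * n) + 7 * n + 4\<close>.\<close>
  moreover have "3 + ?T \<le> 20 * n\<^sup>2"
  proof -
    have "n \<le> n * n" "1 \<le> n * n" using assms(3) by auto
    moreover have "n * (1 + (9 * n + 6)) = 9 * (n * n) + 7 * n" by (simp add: algebra_simps)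
    ultimately show ?thesis unfolding power2_eq_square by linarith
  qed
  moreover have "ready n d x s' \<and> answer n s' = cross_mat n x *\<^sub>v y"
    if "answer_inv n d x y n s'" for s'
  proof
    show "ready n d x s'" using that by (simp add: answer_inv_def)
    show "answer n s' = cross_mat n x *\<^sub>v y"
      using that assms(2)
      by (intro eq_vecI)
        (auto simp: answer_inv_def answer_def cross_mat_def scalar_prod_def lessThan_atLeast0)
  qed
  ultimately show ?thesis by (rule runs_mono)
qed

section \<open>Repeated queries and the final bounds\<close>

text \<open>The correctness lemmas provide some run ending in a \<open>ready\<close> state;
  determinism identifies it with the run at hand.\<close>

lemma serving_ready:
  assumes "serving preprocess answer_query n s0 s"
    "holds_points n d x s0" "n \<ge> 1" "d \<ge> 1" "\<forall>i<n. x i \<in> carrier_vec d"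
  shows "ready n d x s"
  using assms(1)
proof induction
  case (preprocessed t s)
  with preprocess_correct[OF assms(2-4)] show ?case
    unfolding runs_def using exec_deterministic by blast
next
  case (answered s y t s')
  with answer_query_correct[OF answered.IH answered.hyps(2) assms(3-5)] show ?case
    unfolding runs_def using exec_deterministic by blast
qed

theorem theorem16:
  "\<exists>(pre :: prog) (query :: prog) (C :: nat).
     \<forall>(n :: nat) (d :: nat) (x :: nat \<Rightarrow> real vec) (s0 :: state).
       n \<ge> 1 \<longrightarrow> d \<ge> 1 \<longrightarrow> (\<forall>i<n. x i \<in> carrier_vec d) \<longrightarrow> holds_points n d x s0 \<longrightarrow>
         (\<exists>t s. exec pre s0 t s \<and> t \<le> C * (n * d)) \<and>
         (\<forall>s y. serving pre query n s0 s \<longrightarrow> y \<in> carrier_vec n \<longrightarrow>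
            (\<exists>t s'. exec query (load_query y s) t s' \<and> t \<le> C * n\<^sup>2 \<and>
               answer n s' = cross_mat n x *\<^sub>v y))"
proof (rule exI[of _ preprocess], rule exI[of _ answer_query], rule exI[of _ 20],
    intro allI impI conjI)
  fix n d :: nat and x :: "nat \<Rightarrow> real vec" and s0 :: state
  assume *: "n \<ge> 1" "d \<ge> 1" "\<forall>i<n. x i \<in> carrier_vec d" "holds_points n d x s0"
  show "\<exists>t s. exec preprocess s0 t s \<and> t \<le> 20 * (n * d)"
    using preprocess_correct[OF *(4,1,2)] unfolding runs_def by blast
  fix s and y :: "real vec"
  assume "serving preprocess answer_query n s0 s" "y \<in> carrier_vec n"
  then show "\<exists>t s'. exec answer_query (load_query y s) t s' \<and> t \<le> 20 * n\<^sup>2 \<and>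
      answer n s' = cross_mat n x *\<^sub>v y"
    using answer_query_correct[OF serving_ready[OF _ *(4,1,2,3)] _ *(1,2,3)]
    unfolding runs_def by blast
qed

end
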